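(* Let $p$ be a prime greater than $2$. Let $J,K\subseteq\{0,1,\ldots,2p-1\}$ with $|J|=|K|=2$. Then $H_{J,K}$ is a Hadamard submatrix of $\mathcal{F}_{2p}$ if and only if the ordered pair $(\mathcal{P}_{2p}(J),\mathcal{P}_{2p}(K))$ belongs to the set $$\{(\{1,2\},\{1,2\}),\ (\{1,2\},\{1,2p\}),\ (\{1,2p\},\{1,2\})\}.$$
   Context: $\mathcal{F}_m=(e^{2\pi i jk/m})_{0\le j,k\le m-1}$ is the $m\times m$ Fourier matrix. For $J,K\subseteq\{0,\ldots,m-1\}$ with $|J|=|K|=n$, $H_{J,K}=H_{J,K,m}=(e^{2\pi i jk/m})_{j\in J,k\in K}$ is the $n\times n$ submatrix of $\mathcal{F}_m$ with rows $J$ and columns $K$ (each listed in increasing order). An $n\times n$ complex matrix $H$ is Hadamard if all its entries have modulus $1$ and $H^*H=HH^*=nI_n$. For a nonempty finite set $X$ of nonnegative integers, $\mathcal{D}(X)=\{x_1-x_2:x_1,x_2\in X\}$ and $\mathcal{P}_m(X)=\left\{\frac{m}{\gcd(m,d)}:d\in\mathcal{D}(X)\right\}$ (with $\gcd(m,0)=m$). Here $m=2p$. *)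

theory Defs
  imports
    Complex_Main
    "HOL-Computational_Algebra.Primes"
    "Jordan_Normal_Form.Schur_Decomposition"
    "Jordan_Normal_Form.DL_Submatrix"
begin

definition fourier_mat :: "nat \<Rightarrow> complex mat" where
  "fourier_mat m = mat m m (\<lambda>(j, k). exp (2 * of_real pi * \<i> * of_nat (j * k) / of_nat m))"

(* submatrix enumerates the chosen rows and columns in increasing order *)
definition fourier_submat :: "nat \<Rightarrow> nat set \<Rightarrow> nat set \<Rightarrow> complex mat" where
  "fourier_submat m J K = submatrix (fourier_mat m) J K"

definition hadamard_mat :: "complex mat \<Rightarrow> bool" where
  "hadamard_mat H \<longleftrightarrow>
     square_mat H \<and>
     (\<forall>i < dim_row H. \<forall>j < dim_col H. cmod (H $$ (i, j)) = 1) \<and>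
     mat_adjoint H * H = of_nat (dim_row H) \<cdot>\<^sub>m 1\<^sub>m (dim_row H) \<and>
     H * mat_adjoint H = of_nat (dim_row H) \<cdot>\<^sub>m 1\<^sub>m (dim_row H)"

(* Differences are taken in the integers: subtraction on nat would truncate. *)
definition diff_set :: "nat set \<Rightarrow> int set" where
  "diff_set X = {int x1 - int x2 | x1 x2. x1 \<in> X \<and> x2 \<in> X}"

(* div is exact here; the difference 0 contributes m div gcd m 0 = 1 (for m > 0) *)
definition period_set :: "nat \<Rightarrow> nat set \<Rightarrow> int set" where
  "period_set m X = {int m div gcd (int m) d | d. d \<in> diff_set X}"

end

theory Submission
  imports Defs "HOL-Analysis.Complex_Transcendental"
begin

text \<open>
  Write \<open>J = {j, j + a}\<close> and \<open>K = {k, k + b}\<close> with \<open>a, b > 0\<close>.  A \<open>2 \<times> 2\<close> matrix with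
  unimodular entries is Hadamard exactly when its permanent vanishes
  (\<open>hadamard_mat_two_iff\<close>).  The entries of the submatrix are powers of
  \<open>\<omega> = exp (2\<pi>\<i> / (2p))\<close>, and the product of the two diagonal entries is \<open>\<omega> ^ (ab)\<close>
  times that of the two off-diagonal ones, so the permanent vanishes if and only if
  \<open>\<omega> ^ (ab) = -1\<close>, that is, if and only if \<open>ab\<close> is an odd multiple of \<open>p\<close>.

  As \<open>p\<close> is an odd prime, this says that \<open>a\<close> and \<open>b\<close> are both odd and that \<open>p\<close> divides at least one
  of them.  The period sets record precisely this information: the set of a pair at
  distance \<open>d\<close> is \<open>{1, 2p / gcd (2p) d}\<close>, which is \<open>{1, 2}\<close> for \<open>d\<close> odd and divisible by
  \<open>p\<close>, is \<open>{1, 2p}\<close> for \<open>d\<close> odd and not divisible by \<open>p\<close>, and contains no even number when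
  \<open>d\<close> is even (\<open>period_set_pair_eq_iff\<close>).  The three listed pairs are then the combinations of
  the first two kinds in which the first kind occurs.
\<close>

section \<open>Hadamard matrices of order two\<close>

lemma eq_scalar_mat_two_iff:
  assumes "A \<in> carrier_mat 2 2"
  shows "A = c \<cdot>\<^sub>m 1\<^sub>m 2 \<longleftrightarrow>
    A $$ (0,0) = c \<and> A $$ (0,1) = 0 \<and> A $$ (1,0) = 0 \<and> A $$ (1,1) = (c :: 'a :: semiring_1)"
    (is "?L \<longleftrightarrow> ?R")
proof
  assume ?L
  then show ?R by simp
next
  assume R: ?R
  show ?L
  proof (rule eq_matI)
    fix i j assume "i < dim_row (c \<cdot>\<^sub>m 1\<^sub>m 2)" "j < dim_col (c \<cdot>\<^sub>m 1\<^sub>m 2)"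
    then have "i = 0 \<or> i = 1" "j = 0 \<or> j = 1" by auto
    then show "A $$ (i, j) = (c \<cdot>\<^sub>m 1\<^sub>m 2) $$ (i, j)" using R by auto
  qed (use assms in auto)
qed

lemma mat_adjoint_index:
  assumes "A \<in> carrier_mat n n" "i < n" "j < n"
  shows "mat_adjoint A $$ (i, j) = conjugate (A $$ (j, i))"
  using assms unfolding mat_adjoint_def
  by (simp add: mat_of_rows_def)

lemma cnj_mult_self_eq_1: "cmod z = 1 \<Longrightarrow> cnj z * z = 1"
  by (metis complex_norm_square mult.commute of_real_1 power_one)

text \<open>
  Multiplying by \<open>a * c\<close> clears the conjugates, because \<open>cnj a * a = cnj c * c = 1\<close>.
\<close>

lemma unimodular_orthogonal_iff:
  assumes "cmod a = 1" "cmod c = 1"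
  shows "cnj a * b + cnj c * d = 0 \<longleftrightarrow> a * d + b * c = 0"
proof -
  have ac: "cnj a * a = 1" "cnj c * c = 1"
    using assms by (simp_all add: cnj_mult_self_eq_1)
  have "(a * c) * (cnj a * b + cnj c * d) = (cnj a * a) * (b * c) + (cnj c * c) * (a * d)"
    by (simp add: algebra_simps)
  also have "\<dots> = a * d + b * c"
    by (simp add: ac)
  finally have "(a * c) * (cnj a * b + cnj c * d) = a * d + b * c" .
  moreover have "a * c \<noteq> 0" using assms by auto
  ultimately show ?thesis by (metis mult_eq_0_iff)
qed

text \<open>
  Orthogonality of the rows and orthogonality of the columns reduce to the same
  condition, since the permanent is invariant under transposition.
\<close>

lemma hadamard_mat_two_iff:
  assumes H: "H \<in> carrier_mat 2 2"
    and unimod: "\<And>i j. i < 2 \<Longrightarrow> j < 2 \<Longrightarrow> cmod (H $$ (i, j)) = 1"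
  shows "hadamard_mat H \<longleftrightarrow> H $$ (0,0) * H $$ (1,1) + H $$ (0,1) * H $$ (1,0) = 0"
proof -
  define a b c d where "a = H $$ (0,0)" "b = H $$ (0,1)" "c = H $$ (1,0)" "d = H $$ (1,1)"
  note abcd = this
  have norms: "cmod a = 1" "cmod b = 1" "cmod c = 1" "cmod d = 1"
    using unimod unfolding abcd by auto
  note one = norms[THEN cnj_mult_self_eq_1]
  have one': "a * cnj a = 1" "b * cnj b = 1" "c * cnj c = 1" "d * cnj d = 1"
    using one by (simp_all add: mult.commute)
  have adj: "mat_adjoint H \<in> carrier_mat 2 2"
    using H unfolding mat_adjoint_def by auto
  have ent: "mat_adjoint H $$ (0,0) = cnj a" "mat_adjoint H $$ (0,1) = cnj c"
    "mat_adjoint H $$ (1,0) = cnj b" "mat_adjoint H $$ (1,1) = cnj d"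
    unfolding abcd by (simp_all add: mat_adjoint_index[OF H])
  have prod: "(A * B) $$ (i, j) = A $$ (i,0) * B $$ (0,j) + A $$ (i,1) * B $$ (1,j)"
    if "A \<in> carrier_mat 2 2" "B \<in> carrier_mat 2 2" "i < 2" "j < 2"
    for A B :: "complex mat" and i j
    using that by (auto simp: times_mat_def scalar_prod_def numeral_2_eq_2)
  have cols: "mat_adjoint H * H = 2 \<cdot>\<^sub>m 1\<^sub>m 2 \<longleftrightarrow> a * d + b * c = 0"
  proof -
    have "mat_adjoint H * H = 2 \<cdot>\<^sub>m 1\<^sub>m 2 \<longleftrightarrow>
        cnj a * b + cnj c * d = 0 \<and> cnj b * a + cnj d * c = 0"
      using one
      by (subst eq_scalar_mat_two_iff[OF mult_carrier_mat[OF adj H]])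
         (simp add: prod[OF adj H] ent del: One_nat_def flip: abcd)
    then show ?thesis
      using unimodular_orthogonal_iff[of a c b d] unimodular_orthogonal_iff[of b d a c] norms
      by (auto simp: add.commute mult.commute)
  qed
  have rows: "H * mat_adjoint H = 2 \<cdot>\<^sub>m 1\<^sub>m 2 \<longleftrightarrow> a * d + b * c = 0"
  proof -
    have "H * mat_adjoint H = 2 \<cdot>\<^sub>m 1\<^sub>m 2 \<longleftrightarrow>
        a * cnj c + b * cnj d = 0 \<and> c * cnj a + d * cnj b = 0"
      using one'
      by (subst eq_scalar_mat_two_iff[OF mult_carrier_mat[OF H adj]])
         (simp add: prod[OF H adj] ent del: One_nat_def flip: abcd)
    then show ?thesis
      using unimodular_orthogonal_iff[of c d a b] unimodular_orthogonal_iff[of a b c d] norms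
      by (auto simp: add.commute mult.commute)
  qed
  show ?thesis
    using H unimod cols rows unfolding hadamard_mat_def
    by (auto simp del: One_nat_def simp flip: abcd)
qed

section \<open>Two-by-two submatrices of the Fourier matrix\<close>

lemma pick_pair:
  assumes "x < y"
  shows "pick {x, y} 0 = x" "pick {x, y} 1 = y"
proof -
  have "{a \<in> {x, y}. a < x} = {}" "{a \<in> {x, y}. a < y} = {x}"
    using assms by auto
  then have "card {a \<in> {x, y}. a < x} = 0" "card {a \<in> {x, y}. a < y} = 1"
    by simp_all
  then show "pick {x, y} 0 = x" "pick {x, y} 1 = y"
    using pick_card_in_set[of x "{x, y}"] pick_card_in_set[of y "{x, y}"]
    by (metis insertCI)+
qed

text \<open>
  The exponents on the diagonal exceed those off the diagonal by
  \<open>j k + (j + a) (k + b) - j (k + b) - (j + a) k = a b\<close> in total, so the offsets \<open>j\<close> and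
  \<open>k\<close> contribute only a common nonzero factor to the permanent.
\<close>

lemma hadamard_fourier_submat_pair_iff:
  assumes "a > 0" "b > 0" "j + a < m" "k + b < m"
  shows "hadamard_mat (fourier_submat m {j, j + a} {k, k + b}) \<longleftrightarrow>
    exp (2 * of_real pi * \<i> * of_nat (a * b) / of_nat m) = (-1 :: complex)"
proof -
  define w :: "nat \<Rightarrow> complex"
    where "w = (\<lambda>t. exp (2 * of_real pi * \<i> * of_nat t / of_nat m))"
  define H where "H = fourier_submat m {j, j + a} {k, k + b}"
  have w_add: "w (s + t) = w s * w t" for s t
    unfolding w_def by (simp add: exp_add ring_distribs add_divide_distrib)
  have w_norm: "cmod (w t) = 1" for t
    unfolding w_def by (simp add: norm_exp_eq_Re)
  have dims: "{i. i < m \<and> i \<in> {j, j + a}} = {j, j + a}"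
      "{i. i < m \<and> i \<in> {k, k + b}} = {k, k + b}"
    using assms by auto
  have F: "dim_row (fourier_mat m) = m" "dim_col (fourier_mat m) = m"
    unfolding fourier_mat_def by simp_all
  have H: "H \<in> carrier_mat 2 2"
    unfolding H_def fourier_submat_def
    by (rule carrier_matI) (unfold dim_submatrix F dims, use assms in simp_all)
  have H_ent: "H $$ (r, s) = w (pick {j, j + a} r * pick {k, k + b} s)"
    if "r < 2" "s < 2" for r s
  proof -
    have "pick {j, j + a} r < m" "pick {k, k + b} s < m"
      by (rule pick_le, unfold dims, use that assms in simp)+
    moreover have "H $$ (r, s) = fourier_mat m $$ (pick {j, j + a} r, pick {k, k + b} s)"
      unfolding H_def fourier_submat_def
      by (rule submatrix_index) (unfold F dims, use that assms in simp_all)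
    ultimately show ?thesis by (simp add: fourier_mat_def w_def)
  qed
  have ent: "H $$ (0,0) = w (j * k)" "H $$ (0,1) = w (j * (k + b))"
      "H $$ (1,0) = w ((j + a) * k)" "H $$ (1,1) = w ((j + a) * (k + b))"
    using H_ent pick_pair[of j "j + a"] pick_pair[of k "k + b"] assms
    by (simp_all del: pick.simps One_nat_def)
  let ?u = "w (j * (k + b)) * w ((j + a) * k)"
  have split: "j * k + (j + a) * (k + b) = j * (k + b) + (j + a) * k + a * b"
    by (simp add: algebra_simps)
  have "hadamard_mat H \<longleftrightarrow> w (j * k) * w ((j + a) * (k + b)) + ?u = 0"
    by (subst hadamard_mat_two_iff[OF H]) (simp_all add: H_ent w_norm ent del: One_nat_def)
  also have "w (j * k) * w ((j + a) * (k + b)) = ?u * w (a * b)"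
    unfolding w_add[symmetric] split ..
  also have "?u * w (a * b) + ?u = ?u * (w (a * b) + 1)"
    by (simp add: algebra_simps)
  also have "\<dots> = 0 \<longleftrightarrow> w (a * b) = -1"
    unfolding w_def by (simp add: eq_neg_iff_add_eq_0)
  finally show ?thesis unfolding H_def w_def .
qed

lemma exp_root_eq_minus_1_iff:
  assumes "p > 0"
  shows "exp (2 * of_real pi * \<i> * of_nat t / of_nat (2 * p)) = (-1 :: complex) \<longleftrightarrow>
    (\<exists>n::int. int t = (2 * n + 1) * int p)"
proof -
  have "exp (2 * of_real pi * \<i> * of_nat t / of_nat (2 * p)) = (-1 :: complex) \<longleftrightarrow>
      exp (2 * of_real pi * \<i> * of_nat t / of_nat (2 * p)) = exp (of_real pi * \<i>)"
    by simp
  also have "\<dots> \<longleftrightarrow> (\<exists>n::int. 2 * of_real pi * \<i> * of_nat t / of_nat (2 * p)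
      = of_real pi * \<i> + (of_int (2 * n) * pi) * \<i>)"
    unfolding exp_eq by simp
  also have "\<dots> \<longleftrightarrow> (\<exists>n::int. int t = (2 * n + 1) * int p)"
  proof (rule ex_cong1)
    fix n :: int
    have "2 * of_real pi * \<i> * of_nat t / of_nat (2 * p)
          = of_real pi * \<i> + (of_int (2 * n) * pi) * \<i> \<longleftrightarrow>
        (of_real pi * \<i>) * (of_nat t / of_nat p) = (of_real pi * \<i>) * (2 * of_int n + 1 :: complex)"
      by (simp add: algebra_simps)
    also have "\<dots> \<longleftrightarrow> of_nat t / of_nat p = (2 * of_int n + 1 :: complex)"
      by (subst mult_cancel_left) simp
    also have "\<dots> \<longleftrightarrow> (of_int (int t) :: complex) = of_int ((2 * n + 1) * int p)"
      using assms by (simp add: divide_simps)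
    also have "\<dots> \<longleftrightarrow> int t = (2 * n + 1) * int p"
      by (rule of_int_eq_iff)
    finally show "2 * of_real pi * \<i> * of_nat t / of_nat (2 * p)
          = of_real pi * \<i> + (of_int (2 * n) * pi) * \<i> \<longleftrightarrow> int t = (2 * n + 1) * int p" .
  qed
  finally show ?thesis .
qed

lemma odd_multiple_iff:
  assumes "odd p"
  shows "(\<exists>n::int. int t = (2 * n + 1) * int p) \<longleftrightarrow> odd t \<and> p dvd t"
proof
  assume "\<exists>n::int. int t = (2 * n + 1) * int p"
  then obtain n :: int where n: "int t = (2 * n + 1) * int p" by blast
  have "odd (int t)" unfolding n using assms by simp
  moreover have "int p dvd int t" unfolding n by simp
  ultimately show "odd t \<and> p dvd t" by simp
next
  assume t: "odd t \<and> p dvd t"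
  then obtain q where q: "t = p * q" by blast
  with t obtain n where "q = 2 * n + 1" by (auto elim: oddE)
  then have "int t = (2 * int n + 1) * int p" unfolding q by (simp add: algebra_simps)
  then show "\<exists>n::int. int t = (2 * n + 1) * int p" by blast
qed

section \<open>Period sets of pairs\<close>

lemma period_set_pair:
  assumes "m > 0"
  shows "period_set m {x, x + d} = {1, int (m div gcd m d)}"
proof -
  have "diff_set {x, x + d} = {0, int d, - int d}"
    unfolding diff_set_def by force
  then have "period_set m {x, x + d} =
      (\<lambda>d. int m div gcd (int m) d) ` {0, int d, - int d}"
    unfolding period_set_def by blast
  also have "\<dots> = {1, int (m div gcd m d)}"
    using assms by (simp add: gcd_int_int_eq zdiv_int)
  finally show ?thesis .
qed

text \<open>
  For even \<open>d\<close> the factor \<open>2\<close> cancels from \<open>2p / gcd (2p) d\<close>, leaving a divisor of the odd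
  number \<open>p\<close>, so neither \<open>2\<close> nor \<open>2p\<close> can arise.  For odd \<open>d\<close> the gcd is that of \<open>p\<close>
  and \<open>d\<close>, hence \<open>p\<close> or \<open>1\<close>.
\<close>

lemma period_set_pair_eq_iff:
  assumes "prime p" "p > 2"
  shows "period_set (2 * p) {x, x + d} = {1, 2} \<longleftrightarrow> odd d \<and> p dvd d"
    and "period_set (2 * p) {x, x + d} = {1, 2 * int p} \<longleftrightarrow> odd d \<and> \<not> p dvd d"
proof -
  define q where "q = 2 * p div gcd (2 * p) d"
  have odd_p: "odd p" using assms prime_odd_nat by blast
  have q_even: "odd q" if "even d"
  proof -
    obtain e where e: "d = 2 * e" using \<open>even d\<close> by blast
    have "gcd (2 * p) d = 2 * gcd p e"
      unfolding e by (simp add: gcd_mult_distrib_nat)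
    then have "q = p div gcd p e" unfolding q_def by simp
    then have "q dvd p" by (metis gcd_dvd1 dvd_div_mult_self dvd_triv_left)
    then show ?thesis using odd_p by (auto dest: dvd_trans)
  qed
  have q_odd: "q = (if p dvd d then 2 else 2 * p)" if "odd d"
  proof -
    have "coprime d 2" using that by simp
    then have "gcd (2 * p) d = gcd p d" by (rule gcd_mult_left_left_cancel)
    also have "\<dots> = (if p dvd d then p else 1)"
      using assms(1) by (simp add: gcd_nat.absorb1 prime_imp_coprime)
    finally show ?thesis using assms unfolding q_def by simp
  qed
  have P: "period_set (2 * p) {x, x + d} = {1, int q}"
    unfolding q_def using assms by (intro period_set_pair) simp
  have set_eq: "{1, int q} = {1, int r} \<longleftrightarrow> q = r" if "r \<noteq> 1" for r
    using that by (auto simp: doubleton_eq_iff)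
  have "period_set (2 * p) {x, x + d} = {1, 2} \<longleftrightarrow> q = 2"
    unfolding P using set_eq[of 2] by simp
  also have "\<dots> \<longleftrightarrow> odd d \<and> p dvd d"
    using q_even q_odd assms(2) by (cases "even d") auto
  finally show "period_set (2 * p) {x, x + d} = {1, 2} \<longleftrightarrow> odd d \<and> p dvd d" .
  have "period_set (2 * p) {x, x + d} = {1, 2 * int p} \<longleftrightarrow> q = 2 * p"
    unfolding P using set_eq[of "2 * p"] by simp
  also have "\<dots> \<longleftrightarrow> odd d \<and> \<not> p dvd d"
    using q_even q_odd assms(2) by (cases "even d") auto
  finally show "period_set (2 * p) {x, x + d} = {1, 2 * int p} \<longleftrightarrow> odd d \<and> \<not> p dvd d" .
qed

section \<open>Classification\<close>

lemma card_two_natE: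
  fixes X :: "nat set"
  assumes "card X = 2"
  obtains x d where "X = {x, x + d}" "d > 0"
proof -
  obtain x y where "X = {x, y}" "x < y"
    using assms by (metis card_2_iff insert_commute linorder_neqE_nat)
  then show thesis
    using that[of x "y - x"] by simp
qed

theorem theorem3p3:
  fixes p :: nat and J K :: "nat set"
  assumes "prime p" and "p > 2"
    and "J \<subseteq> {0..2 * p - 1}" and "K \<subseteq> {0..2 * p - 1}"
    and "card J = 2" and "card K = 2"
  shows "hadamard_mat (fourier_submat (2 * p) J K) \<longleftrightarrow>
    (period_set (2 * p) J, period_set (2 * p) K) \<in>
      {({1, 2}, {1, 2}), ({1, 2}, {1, 2 * int p}), ({1, 2 * int p}, {1, 2})}"
proof -
  obtain j a where J: "J = {j, j + a}" "a > 0" using card_two_natE[OF assms(5)] .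
  obtain k b where K: "K = {k, k + b}" "b > 0" using card_two_natE[OF assms(6)] .
  have bounds: "j + a < 2 * p" "k + b < 2 * p"
    using assms(2-4) J K by auto
  have odd_p: "odd p" using assms prime_odd_nat by blast
  have "hadamard_mat (fourier_submat (2 * p) J K) \<longleftrightarrow> odd (a * b) \<and> p dvd a * b"
    unfolding J K hadamard_fourier_submat_pair_iff[OF \<open>a > 0\<close> \<open>b > 0\<close> bounds]
    using assms(2) by (subst exp_root_eq_minus_1_iff) (auto simp only: odd_multiple_iff[OF odd_p])
  also have "\<dots> \<longleftrightarrow> odd a \<and> odd b \<and> (p dvd a \<or> p dvd b)"
    using assms(1) by (simp add: prime_dvd_mult_iff)
  also have "\<dots> \<longleftrightarrow> (period_set (2 * p) J, period_set (2 * p) K) \<in>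
      {({1, 2}, {1, 2}), ({1, 2}, {1, 2 * int p}), ({1, 2 * int p}, {1, 2})}"
    unfolding J K insert_iff empty_iff prod.inject period_set_pair_eq_iff[OF assms(1,2)]
    by blast
  finally show ?thesis .
qed

end
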